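(* Fix $\mu>0$ and $r>1$. For the $M/M/s$ queue with arrival rate $\lambda$ and service rate $\mu$, let $\mathbb{E}\xi_\lambda(s)=\mathbb{E}[W_\lambda(s)^r]$ be the $r$-th moment of the steady-state waiting time (time in queue), defined for all real $s>\lambda/\mu$. Then for any $\sigma>0$, $$\lambda\,\mathbb{E}\xi_\lambda\left(\frac{\lambda}{\mu}+\sigma\left(\frac{\lambda}{\mu}\right)^{\frac{1}{r+1}}\right)=\hat q(\sigma)\left(\frac{\lambda}{\mu}\right)^{\frac{1}{r+1}}+\epsilon_\lambda(\sigma)\left(\frac{\lambda}{\mu}\right)^{\frac{3-r}{2(r+1)}},$$ where $\hat q(\sigma)=\sigma^{-r}\,\Gamma(r+1)\,\mu^{1-r}$ and $\epsilon_\lambda(\sigma)=\mathcal{O}(1)$ as $\lambda\to\infty$.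
   Context: For real $s>\lambda/\mu$, with $\rho=\lambda/(s\mu)$, $$\mathbb{E}\xi_\lambda(s)=\mathbb{E}[W_\lambda(s)^r]=\frac{\Gamma(r+1)}{(s\mu-\lambda)^r}\,B(\rho,s),\qquad B(\rho,s)=\left[s\rho\int_0^\infty t\,e^{-s\rho t}(1+t)^{s-1}\,dt\right]^{-1},$$ where for integer $s$, $B(\rho,s)$ is the Erlang-C probability that all $s$ servers are busy in steady state. Notation: $f(\lambda)=\mathcal{O}(g(\lambda))$ means $\limsup_{\lambda\to\infty}|f(\lambda)|/g(\lambda)<\infty$. *)

theory Defs
  imports "HOL-Probability.Probability" "HOL-Library.Landau_Symbols" "HOL-Real_Asymp.Real_Asymp"
begin

text \<open>
  The integral form of the Erlang-C formula, which makes sense for a real number \<open>s\<close> of servers with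
  utilisation \<open>\<rho>\<close>. For integer \<open>s\<close> see \<open>erlang_C_nat\<close> (classical formula) and \<open>mms_prob_all_busy\<close>
  (steady-state probability that all servers are busy).
\<close>

definition erlang_C :: "real \<Rightarrow> real \<Rightarrow> real" where
  "erlang_C \<rho> s =
     inverse (s * \<rho> * (LBINT t=0..\<infinity>. t * exp (- (s * \<rho> * t)) * (1 + t) powr (s - 1)))"

text \<open>
  The law of the steady-state time in queue for real \<open>s > lam / mu\<close>: an arrival is delayed with
  probability \<open>erlang_C\<close>, and its delay is then exponential with rate \<open>s * mu - lam\<close>. Lemma
  \<open>mms_waiting_time_eq\<close> derives this from the queue itself when \<open>s\<close> is an integer;
  \<open>erlang_C_range\<close> shows that the Bernoulli parameter is a genuine probability, so that
  \<^const>\<open>bernoulli_pmf\<close> never truncates it. Lemma \<open>waiting_time_moment_eq\<close> gives the closed form of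
  the moments and their finiteness.
\<close>

definition waiting_time_law :: "real \<Rightarrow> real \<Rightarrow> real \<Rightarrow> real measure" where
  "waiting_time_law lam mu s =
     measure_pmf (bernoulli_pmf (erlang_C (lam / (s * mu)) s)) \<bind>
       (\<lambda>delayed. if delayed
          then density lborel (\<lambda>w. ennreal (exponential_density (s * mu - lam) w))
          else return lborel 0)"

definition waiting_time_moment :: "real \<Rightarrow> real \<Rightarrow> real \<Rightarrow> real \<Rightarrow> real" where
  "waiting_time_moment r mu lam s = (LINT w|waiting_time_law lam mu s. w powr r)"

definition q_hat :: "real \<Rightarrow> real \<Rightarrow> real \<Rightarrow> real" where
  "q_hat r mu \<sigma> = \<sigma> powr (- r) * Gamma (r + 1) * mu powr (1 - r)"

text \<open>
  The queue with \<open>n\<close> servers: \<open>mms_stationary\<close> is global balance for the number of customers in the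
  system. An arrival finds the system in its stationary state; if it finds \<open>k \<ge> n\<close> customers, it
  must wait (first come, first served) for \<open>k - n + 1\<close> departures, which occur at rate \<open>n * mu\<close>. The
  library's \<^const>\<open>erlang_density\<close> has shape one more than its first argument.
\<close>

definition mms_stationary :: "real \<Rightarrow> real \<Rightarrow> nat \<Rightarrow> nat pmf \<Rightarrow> bool" where
  "mms_stationary lam mu n p \<longleftrightarrow>
     (\<forall>k. (lam + real (min k n) * mu) * pmf p k =
          (if k = 0 then 0 else lam * pmf p (k - 1)) + real (min (k + 1) n) * mu * pmf p (k + 1))"

definition mms_waiting_time :: "real \<Rightarrow> nat \<Rightarrow> nat pmf \<Rightarrow> real measure" where
  "mms_waiting_time mu n p =
     measure_pmf p \<bind>
       (\<lambda>k. if k < n then return lborel 0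
            else density lborel (\<lambda>w. ennreal (erlang_density (k - n) (real n * mu) w)))"

text \<open>
  Integration by parts (\<open>erlang_J_rec\<close>) turns the inverse of \<^const>\<open>erlang_C\<close> into
  \<open>1 + (s - a) * erlang_J a (s - 1)\<close> with offered load \<open>a = lam / mu\<close>.
\<close>

definition erlang_J :: "real \<Rightarrow> real \<Rightarrow> real" where
  "erlang_J a p = (LBINT t=0..\<infinity>. exp (- (a * t)) * (1 + t) powr p)"

lemma erlang_J_integrable:
  assumes a: "a > 0"
  shows "interval_lebesgue_integrable lborel 0 \<infinity> (\<lambda>t. exp (- (a * t)) * (1 + t) powr p)"
proof -
  define N where "N = nat \<lceil>\<bar>p\<bar>\<rceil>"
  have N: "p \<le> real N" unfolding N_def by linarith
  define K where "K = fact N * (2 / a) ^ N * exp (a / 2)"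
  define l where "l = a / 2"
  have l: "l > 0" using a by (simp add: l_def)
  have "integrable lborel (\<lambda>x. erlang_density 0 l x)"
  proof (rule integrableI_nonneg)
    show "(\<integral>\<^sup>+ x. ennreal (erlang_density 0 l x) \<partial>lborel) < \<infinity>"
      using nn_integral_erlang_ith_moment[OF l, of 0 0] by simp
  qed (use l in auto)
  hence int: "integrable lborel (\<lambda>x. K / l * erlang_density 0 l x)" by simp
  have bound: "exp (- (a * t)) * (1 + t) powr p \<le> K / l * erlang_density 0 l t" if t: "t > 0" for t
  proof -
    have "(1 + t) powr p \<le> (1 + t) powr real N" using t N by (intro powr_mono) auto
    also have "\<dots> = (1 + t) ^ N" using t by (simp add: powr_realpow)
    also have "\<dots> = fact N * (2 / a) ^ N * ((l * (1 + t)) ^ N / fact N)"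
    proof -
      have "(2 / a) ^ N * (l * (1 + t)) ^ N = (1 + t) ^ N"
      proof -
        have "2 / a * (l * (1 + t)) = 1 + t" using a by (simp add: l_def)
        thus ?thesis unfolding power_mult_distrib[symmetric] by simp
      qed
      thus ?thesis by simp
    qed
    also have "\<dots> \<le> fact N * (2 / a) ^ N * exp (l * (1 + t))"
    proof (rule mult_left_mono)
      have x0: "0 \<le> l * (1 + t)" using l t by simp
      have s: "(\<lambda>n. (l * (1 + t)) ^ n / fact n) sums exp (l * (1 + t))"
        using exp_converges[of "l * (1 + t)"] by (simp add: field_simps)
      have "(\<Sum>n\<in>{N}. (l * (1 + t)) ^ n / fact n) \<le> exp (l * (1 + t))"
        unfolding sums_unique[OF s] using x0 sums_summable[OF s] by (intro sum_le_suminf) auto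
      thus "(l * (1 + t)) ^ N / fact N \<le> exp (l * (1 + t))" by simp
    qed (use a in auto)
    finally have "exp (- (a * t)) * (1 + t) powr p
      \<le> exp (- (a * t)) * (fact N * (2 / a) ^ N * exp (l * (1 + t)))"
      by (intro mult_left_mono) auto
    also have "\<dots> = K * (exp (- (a * t)) * exp (l * t))"
      by (simp add: K_def l_def ring_distribs exp_add)
    also have "exp (- (a * t)) * exp (l * t) = exp (- (l * t))"
      by (simp add: l_def field_simps flip: exp_add)
    also have "K * exp (- (l * t)) = K / l * erlang_density 0 l t"
      using l t by (simp add: erlang_density_def)
    finally show ?thesis .
  qed
  have "set_integrable lborel {0<..} (\<lambda>t. exp (- (a * t)) * (1 + t) powr p)"
    unfolding set_integrable_def
  proof (rule Bochner_Integration.integrable_bound[OF int], measurable, rule AE_I2)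
    fix t :: real
    show "norm (indicator {0<..} t *\<^sub>R (exp (- (a * t)) * (1 + t) powr p))
       \<le> norm (K / l * erlang_density 0 l t)"
      using order_trans[OF bound[of t] abs_ge_self] by (cases "t > 0") auto
  qed
  thus ?thesis
    by (simp add: interval_lebesgue_integrable_def einterval_def greaterThan_def)
qed

lemma erlang_J_rec:
  assumes a: "a > 0"
  shows "a * erlang_J a p = 1 + p * erlang_J a (p - 1)"
proof -
  let ?f = "\<lambda>t. a * (exp (- (a * t)) * (1 + t) powr p) - p * (exp (- (a * t)) * (1 + t) powr (p - 1))"
  let ?F = "\<lambda>t. - (exp (- (a * t)) * (1 + t) powr p)"
  have i1: "interval_lebesgue_integrable lborel 0 \<infinity> (\<lambda>t. a * (exp (- (a * t)) * (1 + t) powr p))"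
    by (intro interval_lebesgue_integrable_mult_right erlang_J_integrable a)
  have i2: "interval_lebesgue_integrable lborel 0 \<infinity> (\<lambda>t. p * (exp (- (a * t)) * (1 + t) powr (p - 1)))"
    by (intro interval_lebesgue_integrable_mult_right erlang_J_integrable a)
  have i: "interval_lebesgue_integrable lborel 0 \<infinity> ?f"
    using i1 i2 by (rule interval_lebesgue_integral_diff(1))
  have "(LBINT t=0..\<infinity>. ?f t) = 0 - (-1)"
  proof (rule interval_integral_FTC_integrable[where F = ?F])
    fix x :: real assume "0 < ereal x" "ereal x < \<infinity>"
    hence x: "x > 0" by simp
    show "(?F has_vector_derivative ?f x) (at x)"
      unfolding has_real_derivative_iff_has_vector_derivative[symmetric]
      using x by (auto intro!: derivative_eq_intros simp: powr_diff field_simps)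
    show "isCont ?f x" using x by (intro continuous_intros) auto
  next
    show "set_integrable lborel (einterval 0 \<infinity>) ?f"
      using i by (simp add: interval_lebesgue_integrable_def)
    have "(?F \<longlongrightarrow> -1) (at_right 0)" using a by real_asymp
    thus "((?F \<circ> real_of_ereal) \<longlongrightarrow> -1) (at_right 0)"
      unfolding zero_ereal_def by (subst ereal_tendsto_simps) 
    have "(?F \<longlongrightarrow> 0) at_top" using a by real_asymp
    thus "((?F \<circ> real_of_ereal) \<longlongrightarrow> 0) (at_left \<infinity>)" by (subst ereal_tendsto_simps)
  qed auto
  moreover have "(LBINT t=0..\<infinity>. ?f t) = a * erlang_J a p - p * erlang_J a (p - 1)"
    using interval_lebesgue_integral_diff(2)[OF i1 i2] by (simp add: erlang_J_def)
  ultimately show ?thesis by simp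
qed

lemma erlang_J_nonneg: "erlang_J a p \<ge> 0"
  unfolding erlang_J_def interval_lebesgue_integral_def set_lebesgue_integral_def
  by (auto intro!: Bochner_Integration.integral_nonneg simp: indicator_def)

lemma erlang_C_eq:
  assumes "lam > 0" "mu > 0" "s > lam / mu"
  defines "a \<equiv> lam / mu"
  shows "erlang_C (lam / (s * mu)) s = inverse (1 + (s - a) * erlang_J a (s - 1))"
proof -
  have a: "a > 0" and s: "s > 0" using assms by (auto intro: less_trans[of 0 "lam/mu"])
  have sr: "s * (lam / (s * mu)) = a" using s by (simp add: a_def)
  have "(LBINT t=0..\<infinity>. t * exp (- (a * t)) * (1 + t) powr (s - 1)) =
        (LBINT t=0..\<infinity>. exp (- (a * t)) * (1 + t) powr s - exp (- (a * t)) * (1 + t) powr (s - 1))"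
  proof (rule interval_integral_cong)
    fix t :: real assume "t \<in> einterval (min 0 \<infinity>) (max 0 \<infinity>)"
    hence t: "t > 0" by (auto simp: einterval_def)
    show "t * exp (- (a * t)) * (1 + t) powr (s - 1) =
      exp (- (a * t)) * (1 + t) powr s - exp (- (a * t)) * (1 + t) powr (s - 1)"
      using t by (simp add: powr_diff field_simps)
  qed
  also have "\<dots> = erlang_J a s - erlang_J a (s - 1)"
    unfolding erlang_J_def
    by (intro interval_lebesgue_integral_diff(2) erlang_J_integrable a)
  finally have "a * (LBINT t=0..\<infinity>. t * exp (- (a * t)) * (1 + t) powr (s - 1)) =
     1 + (s - a) * erlang_J a (s - 1)"
    using erlang_J_rec[OF a, of s] by (simp add: right_diff_distrib left_diff_distrib)
  thus ?thesis unfolding erlang_C_def sr by simp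
qed

lemma erlang_C_range:
  assumes "lam > 0" "mu > 0" "s > lam / mu"
  shows "0 < erlang_C (lam / (s * mu)) s" "erlang_C (lam / (s * mu)) s \<le> 1"
proof -
  have "(s - lam / mu) * erlang_J (lam / mu) (s - 1) \<ge> 0"
    using assms erlang_J_nonneg by (intro mult_nonneg_nonneg) auto
  thus "0 < erlang_C (lam / (s * mu)) s" "erlang_C (lam / (s * mu)) s \<le> 1"
    unfolding erlang_C_eq[OF assms] by (auto simp: add_pos_nonneg inverse_le_1_iff)
qed


lemma waiting_kernel_measurable:
  assumes "\<And>x. prob_space (K x)" "\<And>x. sets (K x) = sets borel"
  shows "K \<in> measurable (measure_pmf p) (subprob_algebra borel)"
  using assms by (auto simp: space_subprob_algebra intro: prob_space_imp_subprob_space)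

lemma nn_integral_waiting_time_law:
  assumes "lam > 0" "mu > 0" "s > lam / mu" and [measurable]: "f \<in> borel_measurable borel"
  defines "C \<equiv> erlang_C (lam / (s * mu)) s"
  shows "(\<integral>\<^sup>+w. f w \<partial>waiting_time_law lam mu s) =
     (\<integral>\<^sup>+w. ennreal (exponential_density (s * mu - lam) w) * f w \<partial>lborel) * ennreal C + f 0 * ennreal (1 - C)"
proof -
  have pos: "s * mu - lam > 0" using assms by (simp add: field_simps)
  let ?K = "\<lambda>b. if b then density lborel (\<lambda>w. ennreal (exponential_density (s * mu - lam) w))
          else return lborel 0"
  have K: "?K \<in> measurable (measure_pmf (bernoulli_pmf C)) (subprob_algebra borel)"
    by (rule waiting_kernel_measurable)
       (use pos in \<open>auto intro: prob_space_erlang_density prob_space_return\<close>)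
  have "(\<integral>\<^sup>+w. f w \<partial>waiting_time_law lam mu s) =
      (\<integral>\<^sup>+b. \<integral>\<^sup>+w. f w \<partial>?K b \<partial>measure_pmf (bernoulli_pmf C))"
    unfolding waiting_time_law_def C_def[symmetric] by (rule nn_integral_bind[OF _ K]) simp
  also have "\<dots> = (\<integral>\<^sup>+w. f w \<partial>?K True) * ennreal C + (\<integral>\<^sup>+w. f w \<partial>?K False) * ennreal (1 - C)"
    using erlang_C_range[OF assms(1-3)] by (subst nn_integral_bernoulli_pmf) (auto simp: C_def)
  also have "(\<integral>\<^sup>+w. f w \<partial>?K True) =
     (\<integral>\<^sup>+w. ennreal (exponential_density (s * mu - lam) w) * f w \<partial>lborel)"
    by (simp add: nn_integral_density)
  also have "(\<integral>\<^sup>+w. f w \<partial>?K False) = f 0"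
    by (simp add: nn_integral_return)
  finally show ?thesis .
qed

lemma nn_integral_exponential_powr:
  assumes l: "l > 0" and r: "r > -1"
  shows "(\<integral>\<^sup>+w. ennreal (exponential_density l w) * ennreal (w powr r) \<partial>lborel) =
     ennreal (Gamma (r + 1) / l powr r)"
proof -
  have "(\<integral>\<^sup>+w. ennreal (exponential_density l w) * ennreal (w powr r) \<partial>lborel) =
    ennreal \<bar>1 / l\<bar> * (\<integral>\<^sup>+x. ennreal (exponential_density l (0 + 1 / l * x)) *
        ennreal ((0 + 1 / l * x) powr r) \<partial>lborel)"
    using l by (intro nn_integral_real_affine) auto
  also have "(\<integral>\<^sup>+x. ennreal (exponential_density l (0 + 1 / l * x)) *
        ennreal ((0 + 1 / l * x) powr r) \<partial>lborel) =
     (\<integral>\<^sup>+x. ennreal (l / l powr r) * ennreal (indicator {0..} x * x powr (r + 1 - 1) / exp x) \<partial>lborel)"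
  proof (rule nn_integral_cong)
    fix x :: real
    show "ennreal (exponential_density l (0 + 1 / l * x)) * ennreal ((0 + 1 / l * x) powr r) =
       ennreal (l / l powr r) * ennreal (indicator {0..} x * x powr (r + 1 - 1) / exp x)"
    proof (cases "x \<ge> 0")
      case True
      have "exponential_density l (x / l) = l * exp (- x)"
        using l True by (simp add: exponential_density_def divide_less_0_iff)
      thus ?thesis using l True
        by (simp add: ennreal_mult[symmetric] powr_divide exp_minus)
           (simp add: divide_inverse mult_ac)
    next
      case False
      thus ?thesis using l by (simp add: exponential_density_def divide_less_0_iff)
    qed
  qed
  also have "\<dots> = ennreal (l / l powr r) * ennreal (Gamma (r + 1))"
    using r by (subst nn_integral_cmult) (auto simp: Gamma_conv_nn_integral_real)
  also have "ennreal \<bar>1 / l\<bar> * \<dots> = ennreal (Gamma (r + 1) / l powr r)"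
    using l r by (simp add: ennreal_mult[symmetric] Gamma_real_nonneg)
  finally show ?thesis .
qed

lemma waiting_time_moment_eq:
  assumes "lam > 0" "mu > 0" "s > lam / mu" "r > 0"
  shows "integrable (waiting_time_law lam mu s) (\<lambda>w. w powr r)"
    and "waiting_time_moment r mu lam s =
           Gamma (r + 1) / (s * mu - lam) powr r * erlang_C (lam / (s * mu)) s"
proof -
  have pos: "s * mu - lam > 0" using assms by (simp add: field_simps)
  let ?G = "Gamma (r + 1) / (s * mu - lam) powr r * erlang_C (lam / (s * mu)) s"
  have G: "Gamma (r + 1) \<ge> 0" using assms by (intro Gamma_real_nonneg) auto
  have nn: "(\<integral>\<^sup>+w. ennreal (w powr r) \<partial>waiting_time_law lam mu s) = ennreal ?G"
  proof -
    have "(\<integral>\<^sup>+w. ennreal (w powr r) \<partial>waiting_time_law lam mu s) =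
        ennreal (Gamma (r + 1) / (s * mu - lam) powr r) * ennreal (erlang_C (lam / (s * mu)) s)"
      using assms(4) pos
      by (subst nn_integral_waiting_time_law[OF assms(1-3)]) (simp_all add: nn_integral_exponential_powr)
    also have "\<dots> = ennreal ?G"
      using G erlang_C_range(1)[OF assms(1-3)] by (subst ennreal_mult) simp_all
    finally show ?thesis .
  qed
  have "sets (waiting_time_law lam mu s) = sets borel"
    unfolding waiting_time_law_def by (subst sets_bind[where N = borel]) auto
  hence m: "(\<lambda>w. w powr r) \<in> borel_measurable (waiting_time_law lam mu s)"
    by (subst measurable_cong_sets[OF _ refl]) auto
  have "has_bochner_integral (waiting_time_law lam mu s) (\<lambda>w. w powr r) ?G"
    using m nn G erlang_C_range[OF assms(1-3)]
    by (intro has_bochner_integral_nn_integral) auto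
  thus "integrable (waiting_time_law lam mu s) (\<lambda>w. w powr r)"
    and "waiting_time_moment r mu lam s = ?G"
    by (auto simp: waiting_time_moment_def has_bochner_integral_iff)
qed

lemma erlang_J_nat:
  assumes a: "a > 0"
  shows "a ^ Suc n / fact n * erlang_J a (real n) = (\<Sum>k\<le>n. a ^ k / fact k)"
proof (induction n)
  case 0
  show ?case using erlang_J_rec[OF a, of 0] by simp
next
  case (Suc n)
  have "a ^ Suc (Suc n) / fact (Suc n) * erlang_J a (real (Suc n)) =
     a ^ Suc n / fact (Suc n) * (a * erlang_J a (real (Suc n)))" by simp
  also have "a * erlang_J a (real (Suc n)) = 1 + real (Suc n) * erlang_J a (real n)"
    using erlang_J_rec[OF a, of "real (Suc n)"] by simp
  also have "a ^ Suc n / fact (Suc n) * \<dots> =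
      a ^ Suc n / fact (Suc n) + a ^ Suc n / fact n * erlang_J a (real n)"
  proof -
    have "fact (Suc n) = real (Suc n) * fact n" by (rule fact_Suc)
    thus ?thesis by (simp add: distrib_left del: of_nat_Suc fact_Suc power_Suc)
  qed
  finally show ?case using Suc by simp
qed

lemma erlang_C_nat:
  assumes "lam > 0" "mu > 0" "real n > lam / mu"
  defines "a \<equiv> lam / mu"
  shows "erlang_C (lam / (real n * mu)) (real n) =
     (a ^ n / fact n * (real n / (real n - a))) /
     ((\<Sum>k<n. a ^ k / fact k) + a ^ n / fact n * (real n / (real n - a)))"
proof -
  have a: "a > 0" and n: "real n > a" using assms by auto
  then obtain m where m: "n = Suc m" by (cases n) auto
  define S where "S = (\<Sum>k<n. a ^ k / fact k)"
  define J where "J = erlang_J a (real n - 1)"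
  have S: "S = a ^ n / fact m * J"
    using erlang_J_nat[OF a, of m] by (simp add: S_def J_def m lessThan_Suc_atMost)
  have J: "J \<ge> 0" unfolding J_def by (rule erlang_J_nonneg)
  have d: "1 + (real n - a) * J > 0" using n J by (intro add_pos_nonneg) auto
  define E where "E = a ^ n / fact n * (real n / (real n - a))"
  have n': "real n - a \<noteq> 0" "real n \<noteq> 0" using n a by auto
  have "fact n = real n * fact m" unfolding m by (rule fact_Suc)
  hence E: "E = a ^ n / fact m / (real n - a)" using n' by (simp add: E_def)
  have "S = E * ((real n - a) * J)" using n' by (simp add: S E)
  hence "S + E = E * (1 + (real n - a) * J)" by (simp add: distrib_left)
  moreover have "E \<noteq> 0" using a n' by (simp add: E)
  ultimately show ?thesis
    unfolding erlang_C_eq[OF assms(1-3)] a_def[symmetric] S_def[symmetric] J_def[symmetric] E_def[symmetric]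
    using d by (simp add: divide_inverse mult_ac)
qed

text \<open>The unnormalised solution of the balance equations.\<close>

definition mms_weight :: "real \<Rightarrow> nat \<Rightarrow> nat \<Rightarrow> real" where
  "mms_weight a n k = (if k < n then a ^ k / fact k else a ^ n / fact n * (a / n) ^ (k - n))"

lemma mms_weight_sums:
  assumes "0 < a" "a < real n"
  shows "mms_weight a n sums ((\<Sum>k<n. a ^ k / fact k) + a ^ n / fact n * (real n / (real n - a)))"
proof -
  have "(\<lambda>j. a ^ n / fact n * (a / real n) ^ j) sums (a ^ n / fact n * (1 / (1 - a / real n)))"
    using assms by (intro sums_mult geometric_sums) auto
  also have "1 / (1 - a / real n) = real n / (real n - a)"
    using assms by (simp add: field_simps)
  finally have "(\<lambda>j. mms_weight a n (j + n)) sums (a ^ n / fact n * (real n / (real n - a)))"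
    by (simp add: mms_weight_def)
  from sums_offset[OF this] show ?thesis
    by (simp add: mms_weight_def[abs_def] add.commute)
qed

lemma mms_weight_Suc:
  assumes "n > 0"
  shows "a * mms_weight a n k = real (min (k + 1) n) * mms_weight a n (k + 1)"
proof -
  consider "k + 1 < n" | "k + 1 = n" | "k \<ge> n" by linarith
  thus ?thesis
  proof cases
    case 1
    have "fact (Suc k) = real (Suc k) * fact k" by (rule fact_Suc)
    thus ?thesis using 1 by (simp add: mms_weight_def del: of_nat_Suc fact_Suc)
  next
    case 2
    have "fact (Suc k) = real (Suc k) * fact k" by (rule fact_Suc)
    thus ?thesis using 2[symmetric] by (simp add: mms_weight_def del: of_nat_Suc fact_Suc)
  next
    case 3
    thus ?thesis using assms by (simp add: mms_weight_def Suc_diff_le)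
  qed
qed

lemma mms_stationary_weight:
  assumes "lam > 0" "mu > 0" "n > 0" "mms_stationary lam mu n p"
  shows "pmf p k = pmf p 0 * mms_weight (lam / mu) n k"
proof -
  have bal: "lam * pmf p k = real (min (k + 1) n) * mu * pmf p (k + 1)" for k
  proof (induction k)
    case 0
    show ?case using assms(4)[unfolded mms_stationary_def, rule_format, of 0] by simp
  next
    case (Suc k)
    thus ?case using assms(4)[unfolded mms_stationary_def, rule_format, of "Suc k"]
      by (simp add: algebra_simps)
  qed
  show ?thesis
  proof (induction k)
    case 0
    show ?case using assms by (simp add: mms_weight_def)
  next
    case (Suc k)
    have "real (min (k + 1) n) * pmf p (k + 1) = lam / mu * pmf p k"
      using bal[of k] assms by (simp add: field_simps)
    also have "\<dots> = real (min (k + 1) n) * (pmf p 0 * mms_weight (lam / mu) n (k + 1))"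
      unfolding Suc using mms_weight_Suc[OF assms(3), of "lam / mu" k] by (simp add: mult_ac)
    finally have "pmf p (k + 1) = pmf p 0 * mms_weight (lam / mu) n (k + 1)"
      using assms(3) by (subst (asm) mult_cancel_left) (auto simp: min_def split: if_splits)
    thus ?case by simp
  qed
qed

lemma pmf_nat_sums:
  fixes p :: "nat pmf"
  shows "(\<lambda>k. pmf p k) sums 1"
proof -
  have "(\<Sum>k. ennreal (pmf p k)) = emeasure (measure_pmf p) UNIV"
    by (simp add: nn_integral_pmf flip: nn_integral_count_space_nat)
  also have "\<dots> = 1" using measure_pmf.emeasure_space_1[of p] by simp
  finally have "(\<lambda>k. ennreal (pmf p k)) sums ennreal 1"
    by (metis ennreal_1 summableI summable_sums)
  thus ?thesis by (subst (asm) sums_ennreal) auto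
qed

lemma mms_stationary_pmf:
  assumes "lam > 0" "mu > 0" "real n > lam / mu" "mms_stationary lam mu n p"
  defines "C \<equiv> erlang_C (lam / (real n * mu)) (real n)" and "\<rho> \<equiv> lam / (real n * mu)"
  shows "pmf p (n + j) = C * (1 - \<rho>) * \<rho> ^ j" and "(\<Sum>k<n. pmf p k) = 1 - C"
proof -
  define a where "a = lam / mu"
  have a: "a > 0" and an: "a < real n" using assms by (auto simp: a_def)
  hence n: "n > 0" by (cases n) auto
  define W where "W = a ^ n / fact n * (real n / (real n - a))"
  define S where "S = (\<Sum>k<n. a ^ k / fact k)"
  have W: "W > 0" using a an by (auto simp: W_def)
  have S: "S \<ge> 0" using a by (auto simp: S_def intro!: sum_nonneg)
  have p: "pmf p k = pmf p 0 * mms_weight a n k" for k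
    unfolding a_def by (rule mms_stationary_weight[OF assms(1,2) n assms(4)])
  have "(\<lambda>k. pmf p 0 * mms_weight a n k) sums (pmf p 0 * (S + W))"
    unfolding S_def W_def by (rule sums_mult[OF mms_weight_sums[OF a an]])
  also have "(\<lambda>k. pmf p 0 * mms_weight a n k) = (\<lambda>k. pmf p k)"
    by (intro ext p[symmetric])
  finally have "(\<lambda>k. pmf p k) sums (pmf p 0 * (S + W))" .
  hence p0: "pmf p 0 * (S + W) = 1" using pmf_nat_sums sums_unique2 by blast
  hence p0': "pmf p 0 = 1 / (S + W)" using S W by (simp add: field_simps)
  have C: "C = W / (S + W)"
    unfolding C_def erlang_C_nat[OF assms(1-3)] a_def[symmetric] W_def S_def by simp
  have rho: "\<rho> = a / real n" by (simp add: \<rho>_def a_def mult.commute)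
  have "W * (1 - \<rho>) = a ^ n / fact n"
    using an n by (simp add: W_def rho diff_divide_distrib[symmetric] field_simps)
  hence "pmf p 0 * (a ^ n / fact n) = C * (1 - \<rho>)" by (simp add: p0' C)
  moreover have "pmf p (n + j) = pmf p 0 * (a ^ n / fact n) * \<rho> ^ j"
    using p[of "n + j"] by (simp add: mms_weight_def rho)
  ultimately show "pmf p (n + j) = C * (1 - \<rho>) * \<rho> ^ j" by simp
  have "(\<Sum>k<n. pmf p k) = pmf p 0 * S"
    unfolding S_def sum_distrib_left
  proof (rule sum.cong[OF refl])
    fix k assume "k \<in> {..<n}"
    thus "pmf p k = pmf p 0 * (a ^ k / fact k)" using p[of k] by (simp add: mms_weight_def)
  qed
  also have "\<dots> = 1 - C" using S W by (simp add: p0' C field_simps)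
  finally show "(\<Sum>k<n. pmf p k) = 1 - C" .
qed

lemma mms_prob_all_busy:
  assumes "lam > 0" "mu > 0" "real n > lam / mu" "mms_stationary lam mu n p"
  shows "measure_pmf.prob p {n..} = erlang_C (lam / (real n * mu)) (real n)"
proof -
  have "measure_pmf.prob p {n..} = measure_pmf.prob p (UNIV - {..<n})"
    by (intro arg_cong[where f = "measure_pmf.prob p"]) auto
  also have "\<dots> = 1 - measure_pmf.prob p {..<n}"
    using measure_pmf.prob_compl[of "{..<n}" p] by simp
  also have "measure_pmf.prob p {..<n} = (\<Sum>k<n. pmf p k)"
    by (rule measure_measure_pmf_finite) simp
  finally show ?thesis using mms_stationary_pmf(2)[OF assms] by simp
qed

lemma mms_stationary_exists:
  assumes "lam > 0" "mu > 0" "real n > lam / mu"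
  shows "\<exists>p. mms_stationary lam mu n p"
proof -
  define a where "a = lam / mu"
  have a: "a > 0" and an: "a < real n" using assms by (auto simp: a_def)
  hence n: "n > 0" by (cases n) auto
  obtain Z where Z: "mms_weight a n sums Z" using mms_weight_sums[OF a an] by blast
  have nn: "mms_weight a n k \<ge> 0" for k using a by (simp add: mms_weight_def)
  have "(\<Sum>k\<in>{0}. mms_weight a n k) \<le> Z"
    unfolding sums_unique[OF Z] using nn sums_summable[OF Z] by (intro sum_le_suminf) auto
  moreover have "mms_weight a n 0 = 1" using n by (simp add: mms_weight_def)
  ultimately have Z0: "Z > 0" by simp
  define f where "f k = mms_weight a n k / Z" for k
  have f: "f k \<ge> 0" for k using nn Z0 by (simp add: f_def)
  have "f sums 1" using sums_divide[OF Z, of Z] Z0 by (simp add: f_def[abs_def])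
  hence "(\<lambda>k. ennreal (f k)) sums ennreal 1" using f by (subst sums_ennreal) auto
  hence f1: "(\<integral>\<^sup>+k. ennreal (f k) \<partial>count_space UNIV) = 1"
    by (simp add: nn_integral_count_space_nat sums_iff)
  define p where "p = embed_pmf f"
  have p: "pmf p k = f k" for k unfolding p_def using f f1 by (rule pmf_embed_pmf)
  have bal: "lam * f k = real (min (k + 1) n) * mu * f (k + 1)" for k
  proof -
    have "lam * f k = mu * (a * mms_weight a n k) / Z" using assms by (simp add: f_def a_def)
    thus ?thesis unfolding mms_weight_Suc[OF n] by (simp add: f_def mult_ac)
  qed
  have "mms_stationary lam mu n p" unfolding mms_stationary_def p
  proof
    fix k
    show "(lam + real (min k n) * mu) * f k =
          (if k = 0 then 0 else lam * f (k - 1)) + real (min (k + 1) n) * mu * f (k + 1)"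
      using bal[of k] bal[of "k - 1"] by (cases k) (simp_all add: distrib_right)
  qed
  thus ?thesis ..
qed

lemma erlang_mixture:
  assumes "0 \<le> \<rho>" "\<rho> < 1" "l > 0" "0 \<le> C"
  shows "(\<Sum>j. ennreal (C * (1 - \<rho>) * \<rho> ^ j) * ennreal (erlang_density j l x)) =
     ennreal (exponential_density (l * (1 - \<rho>)) x) * ennreal C"
proof (cases "x < 0")
  case True
  thus ?thesis by (simp add: erlang_density_def)
next
  case False
  have "(\<lambda>j. C * (1 - \<rho>) * l * exp (- (l * x)) * ((\<rho> * l * x) ^ j /\<^sub>R fact j)) sums
      (C * (1 - \<rho>) * l * exp (- (l * x)) * exp (\<rho> * l * x))"
    by (intro sums_mult exp_converges)
  also have "(\<lambda>j. C * (1 - \<rho>) * l * exp (- (l * x)) * ((\<rho> * l * x) ^ j /\<^sub>R fact j)) =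
     (\<lambda>j. C * (1 - \<rho>) * \<rho> ^ j * erlang_density j l x)"
    using False by (auto simp: erlang_density_def power_mult_distrib divide_inverse mult_ac)
  also have "C * (1 - \<rho>) * l * exp (- (l * x)) * exp (\<rho> * l * x) =
     C * (1 - \<rho>) * l * exp (- (l * x) + \<rho> * l * x)" by (simp only: exp_add mult.assoc)
  also have "\<dots> = exponential_density (l * (1 - \<rho>)) x * C"
    using False by (simp add: exponential_density_def algebra_simps)
  finally have *: "(\<lambda>j. C * (1 - \<rho>) * \<rho> ^ j * erlang_density j l x) sums
      (exponential_density (l * (1 - \<rho>)) x * C)" .
  have "(\<lambda>j. ennreal (C * (1 - \<rho>) * \<rho> ^ j * erlang_density j l x)) sums
      ennreal (exponential_density (l * (1 - \<rho>)) x * C)"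
    using * assms by (subst sums_ennreal) auto
  thus ?thesis using assms by (simp add: sums_iff ennreal_mult)
qed

lemma mms_waiting_time_eq:
  assumes "lam > 0" "mu > 0" "real n > lam / mu" "mms_stationary lam mu n p"
  shows "mms_waiting_time mu n p = waiting_time_law lam mu (real n)"
proof (rule measure_eqI)
  have n: "n > 0" using assms by (cases n) (auto simp: not_less divide_less_0_iff)
  define l where "l = real n * mu"
  have l: "l > 0" using n assms by (simp add: l_def)
  define \<rho> where "\<rho> = lam / (real n * mu)"
  define C where "C = erlang_C (lam / (real n * mu)) (real n)"
  have \<rho>: "0 \<le> \<rho>" "\<rho> < 1" "l * (1 - \<rho>) = real n * mu - lam"
    using assms n by (auto simp: \<rho>_def l_def field_simps)
  have C: "0 \<le> C" "C \<le> 1" using erlang_C_range[OF assms(1-3)] by (auto simp: C_def)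
  let ?K = "\<lambda>k. if k < n then return lborel 0
            else density lborel (\<lambda>w. ennreal (erlang_density (k - n) (real n * mu) w))"
  have K: "?K \<in> measurable (measure_pmf p) (subprob_algebra borel)"
    by (rule waiting_kernel_measurable)
       (use l in \<open>auto simp: l_def intro: prob_space_erlang_density prob_space_return\<close>)
  have s1: "sets (mms_waiting_time mu n p) = sets borel"
    unfolding mms_waiting_time_def by (rule sets_bind) auto
  have s2: "sets (waiting_time_law lam mu (real n)) = sets borel"
    unfolding waiting_time_law_def by (rule sets_bind) auto
  show "sets (mms_waiting_time mu n p) = sets (waiting_time_law lam mu (real n))"
    using s1 s2 by simp
  fix A assume "A \<in> sets (mms_waiting_time mu n p)"
  hence A[measurable]: "A \<in> sets borel" using s1 by simp
  let ?g = "\<lambda>k. ennreal (pmf p k) * emeasure (?K k) A"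
  have "emeasure (mms_waiting_time mu n p) A = (\<integral>\<^sup>+k. emeasure (?K k) A \<partial>measure_pmf p)"
    unfolding mms_waiting_time_def by (rule emeasure_bind[OF _ K A]) simp
  also have "\<dots> = (\<Sum>k. ?g k)"
    by (simp add: nn_integral_measure_pmf nn_integral_count_space_nat)
  also have "\<dots> = (\<Sum>j. ?g (j + n)) + (\<Sum>k<n. ?g k)"
    by (rule suminf_offset) (rule summableI)
  also have "(\<Sum>k<n. ?g k) = (\<Sum>k<n. ennreal (pmf p k)) * indicator A 0"
    by (cases "0 \<in> A") simp_all
  also have "(\<Sum>k<n. ennreal (pmf p k)) = ennreal (1 - C)"
    using mms_stationary_pmf(2)[OF assms] by (subst sum_ennreal) (simp_all add: C_def)
  also have "(\<Sum>j. ?g (j + n)) =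
     (\<Sum>j. \<integral>\<^sup>+x. ennreal (C * (1 - \<rho>) * \<rho> ^ j) * ennreal (erlang_density j l x) * indicator A x \<partial>lborel)"
  proof (rule suminf_cong)
    fix j
    have "?g (j + n) = ennreal (C * (1 - \<rho>) * \<rho> ^ j) *
        (\<integral>\<^sup>+x. ennreal (erlang_density j l x) * indicator A x \<partial>lborel)"
      using mms_stationary_pmf(1)[OF assms, of j]
      by (simp add: emeasure_density add.commute C_def \<rho>_def l_def)
    thus "?g (j + n) = (\<integral>\<^sup>+x. ennreal (C * (1 - \<rho>) * \<rho> ^ j) * ennreal (erlang_density j l x) * indicator A x \<partial>lborel)"
      by (simp add: nn_integral_cmult mult.assoc)
  qed
  also have "\<dots> = (\<integral>\<^sup>+x. (\<Sum>j. ennreal (C * (1 - \<rho>) * \<rho> ^ j) * ennreal (erlang_density j l x) * indicator A x) \<partial>lborel)"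
    by (rule nn_integral_suminf[symmetric]) measurable
  also have "\<dots> = (\<integral>\<^sup>+x. ennreal (exponential_density (real n * mu - lam) x) * indicator A x * ennreal C \<partial>lborel)"
    unfolding ennreal_suminf_multc erlang_mixture[OF \<rho>(1,2) l C(1)] \<rho>(3)
    by (intro nn_integral_cong) (simp add: mult_ac)
  also have "\<dots> = (\<integral>\<^sup>+x. ennreal (exponential_density (real n * mu - lam) x) * indicator A x \<partial>lborel) * ennreal C"
    by (rule nn_integral_multc) measurable
  also have "\<dots> + ennreal (1 - C) * indicator A 0 =
      (\<integral>\<^sup>+w. indicator A w \<partial>waiting_time_law lam mu (real n))"
    by (subst nn_integral_waiting_time_law[OF assms(1-3)]) (simp_all add: C_def mult.commute)
  also have "\<dots> = emeasure (waiting_time_law lam mu (real n)) A"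
    using A s2 by (intro nn_integral_indicator) simp
  finally show "emeasure (mms_waiting_time mu n p) A = emeasure (waiting_time_law lam mu (real n)) A" .
qed

end

theory Submission
  imports Defs
begin

text \<open>
  Put \<open>a = lam / mu\<close> for the offered load and let \<open>s = a + d\<close> with \<open>d = \<sigma> * a powr (1 / (r + 1))\<close>. The
  closed form of the waiting-time moment says that \<open>lam * waiting_time_moment r mu lam s\<close> is exactly
  \<open>q_hat r mu \<sigma> * a powr (1 / (r + 1))\<close> times the probability \<open>C\<close> of delay
  (\<open>scaled_waiting_time_moment\<close>). So the whole error term comes from \<open>1 - C\<close>, and what has
  to be shown is that \<open>1 - C\<close> is at most of order \<open>d / sqrt a\<close>.

  Now \<open>1 / C = 1 + d * erlang_J a (s - 1)\<close>, so \<open>1 - C\<close> is at most \<open>d * erlang_J a (s - 1)\<close>, and it is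
  enough to bound the integral \<open>erlang_J a (s - 1)\<close> by a constant multiple of \<open>1 / sqrt a\<close>
  (\<open>erlang_J_le_inverse_sqrt\<close>). This is where \<open>r > 1\<close> enters: it makes \<open>d\<close> negligible against
  \<open>sqrt a\<close>, so that for large \<open>lam\<close> the exponent \<open>s - 1\<close> exceeds \<open>a\<close> by at most \<open>sqrt a / 4\<close>. The
  integrand \<open>exp (- a * t) * (1 + t) powr (s - 1)\<close> is then essentially
  \<open>exp (- a * (t - ln (1 + t)))\<close>, a bump of width \<open>1 / sqrt a\<close> at the origin.
\<close>

text \<open>
  Both sides vanish at the origin, and the derivative of the left side exceeds that of the right
  side by \<open>t\<^sup>2 / (2 * (1 + t)\<^sup>2)\<close>.
\<close>

lemma minus_ln_add_one_ge_quadratic: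
  fixes t :: real
  assumes "t \<ge> 0"
  shows "t - ln (1 + t) \<ge> t\<^sup>2 / (2 * (1 + t))"
proof -
  let ?f = "\<lambda>t::real. t - ln (1 + t) - t\<^sup>2 / (2 * (1 + t))"
  have "?f 0 \<le> ?f t"
  proof (rule DERIV_nonneg_imp_nondecreasing[OF assms])
    fix x :: real assume x: "0 \<le> x" "x \<le> t"
    have "(?f has_real_derivative
        (1 - 1 / (1 + x) - (2 * x * (2 * (1 + x)) - x\<^sup>2 * 2) / (2 * (1 + x))\<^sup>2)) (at x)"
      using x by (auto intro!: derivative_eq_intros simp: power2_eq_square)
    also have "1 - 1 / (1 + x) - (2 * x * (2 * (1 + x)) - x\<^sup>2 * 2) / (2 * (1 + x))\<^sup>2 =
        x\<^sup>2 / (2 * (1 + x)\<^sup>2)"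
      using x by (simp add: divide_simps) (simp add: power2_eq_square algebra_simps)
    finally have "(?f has_real_derivative x\<^sup>2 / (2 * (1 + x)\<^sup>2)) (at x)" .
    thus "\<exists>y. (?f has_real_derivative y) (at x) \<and> 0 \<le> y"
      by (intro exI conjI) auto
  qed
  thus ?thesis by simp
qed

text \<open>
  The quadratic decay near the origin weakens to linear decay for large \<open>t\<close>, so on the scale
  \<open>u = sqrt a * t\<close> a bound uniform in \<open>a\<close> can be at most linear in \<open>u\<close>. Here it is \<open>(u - 1) / 2\<close>,
  whose slope absorbs the extra \<open>u / 4\<close> that the surplus \<open>sqrt a / 4\<close> in the exponent \<open>p\<close> can contribute.
\<close>

lemma erlang_integrand_le_exponential:
  fixes a p t :: real
  assumes a: "a \<ge> 1" and p: "p \<le> a + sqrt a / 4" and t: "t \<ge> 0"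
  shows "exp (- (a * t)) * (1 + t) powr p \<le> exp (1 / 2) * exp (- (sqrt a / 4 * t))"
proof -
  define u where "u = sqrt a * t"
  have u: "u \<ge> 0" using a t by (simp add: u_def)
  have ut: "t \<le> u"
    using mult_right_mono[of 1 "sqrt a" t] a t by (simp add: u_def)
  have "(u - 1) / 2 \<le> u\<^sup>2 / (2 * (1 + u))"
    using u by (simp add: field_simps power2_eq_square)
  also have "\<dots> \<le> u\<^sup>2 / (2 * (1 + t))"
    using u t ut by (intro divide_left_mono) auto
  also have "\<dots> = a * (t\<^sup>2 / (2 * (1 + t)))"
    using a by (simp add: u_def power_mult_distrib)
  also have "\<dots> \<le> a * (t - ln (1 + t))"
    using a t by (intro mult_left_mono minus_ln_add_one_ge_quadratic) auto
  finally have main: "(u - 1) / 2 \<le> a * t - a * ln (1 + t)"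
    by (simp add: right_diff_distrib)
  have "p * ln (1 + t) \<le> (a + sqrt a / 4) * ln (1 + t)"
    using p t by (intro mult_right_mono) auto
  also have "\<dots> \<le> a * ln (1 + t) + sqrt a / 4 * t"
    using a t ln_add_one_self_le_self[OF t]
    by (auto simp: distrib_right intro!: mult_left_mono)
  finally have "- (a * t) + p * ln (1 + t) \<le> 1 / 2 - sqrt a / 4 * t"
    using main by (simp add: u_def field_simps)
  hence "exp (- (a * t) + p * ln (1 + t)) \<le> exp (1 / 2 - sqrt a / 4 * t)" by simp
  thus ?thesis using t by (simp add: powr_def mult_exp_exp)
qed

text \<open>
  The dominating exponential is itself an integrand of \<^const>\<open>erlang_J\<close>, with exponent \<open>0\<close>, and for
  that exponent the recurrence evaluates the integral.
\<close>

lemma erlang_J_le_inverse_sqrt: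
  fixes a p :: real
  assumes a: "a \<ge> 1" and p: "p \<le> a + sqrt a / 4"
  shows "erlang_J a p \<le> 4 * exp (1 / 2) / sqrt a"
proof -
  let ?b = "sqrt a / 4"
  have b: "?b > 0" using a by simp
  have "erlang_J a p \<le> (LBINT t=0..\<infinity>. exp (1 / 2) * (exp (- (?b * t)) * (1 + t) powr 0))"
    unfolding erlang_J_def interval_lebesgue_integral_def
  proof (simp only: ereal_less_eq if_True zero_ereal_def, rule set_integral_mono)
    show "set_integrable lborel (einterval (ereal 0) \<infinity>) (\<lambda>t. exp (- (a * t)) * (1 + t) powr p)"
      using erlang_J_integrable[of a p] a
      by (simp add: interval_lebesgue_integrable_def zero_ereal_def)
    show "set_integrable lborel (einterval (ereal 0) \<infinity>)
        (\<lambda>t. exp (1 / 2) * (exp (- (?b * t)) * (1 + t) powr 0))"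
      using erlang_J_integrable[OF b, of 0]
      by (intro set_integrable_mult_right)
         (simp add: interval_lebesgue_integrable_def zero_ereal_def)
    fix t assume "t \<in> einterval (ereal 0) \<infinity>"
    hence "t > 0" by (simp add: einterval_def)
    thus "exp (- (a * t)) * (1 + t) powr p \<le> exp (1 / 2) * (exp (- (?b * t)) * (1 + t) powr 0)"
      using erlang_integrand_le_exponential[OF a p, of t] by simp
  qed
  also have "\<dots> = exp (1 / 2) * erlang_J ?b 0" by (simp add: erlang_J_def)
  also have "erlang_J ?b 0 = 4 / sqrt a"
    using erlang_J_rec[OF b, of 0] a by (simp add: field_simps)
  finally show ?thesis by (simp add: mult_ac)
qed

lemma one_minus_erlang_C_le:
  assumes "lam > 0" "mu > 0" "s > lam / mu"
  shows "1 - erlang_C (lam / (s * mu)) s \<le> (s - lam / mu) * erlang_J (lam / mu) (s - 1)"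
proof -
  define x where "x = (s - lam / mu) * erlang_J (lam / mu) (s - 1)"
  have "x \<ge> 0" using assms erlang_J_nonneg by (auto simp: x_def)
  hence "1 - inverse (1 + x) \<le> x" by (simp add: field_simps)
  thus ?thesis unfolding erlang_C_eq[OF assms] x_def .
qed

text \<open>
  The surplus capacity \<open>s * mu - lam\<close> is \<open>mu * \<sigma> * (lam / mu) powr (1 / (r + 1))\<close>; its power \<open>- r\<close>
  times \<open>lam\<close> leaves \<open>lam / mu\<close> to the power \<open>1 - r / (r + 1) = 1 / (r + 1)\<close>.
\<close>

lemma scaled_waiting_time_moment:
  fixes mu r lam \<sigma> :: real
  assumes "mu > 0" "r > 0" "lam > 0" "\<sigma> > 0"
  defines "s \<equiv> lam / mu + \<sigma> * (lam / mu) powr (1 / (r + 1))"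
  shows "lam * waiting_time_moment r mu lam s =
    q_hat r mu \<sigma> * (lam / mu) powr (1 / (r + 1)) * erlang_C (lam / (s * mu)) s"
proof -
  define a where "a = lam / mu"
  have a: "a > 0" and lam: "lam = mu * a" using assms by (auto simp: a_def)
  have s: "s > lam / mu" using assms by (simp add: s_def)
  have "s * mu - lam = mu * \<sigma> * a powr (1 / (r + 1))"
    using assms(1) by (simp add: s_def a_def field_simps)
  hence "(s * mu - lam) powr r = mu powr r * \<sigma> powr r * a powr (r / (r + 1))"
    using assms a by (simp add: powr_mult powr_powr)
  moreover have "a = a powr (1 / (r + 1)) * a powr (r / (r + 1))"
    using a assms(2) by (simp add: add.commute flip: powr_add add_divide_distrib)
  ultimately have "lam / (s * mu - lam) powr r =
      mu * (a powr (1 / (r + 1)) * a powr (r / (r + 1))) /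
      (mu powr r * \<sigma> powr r * a powr (r / (r + 1)))"
    using lam by simp
  also have "\<dots> = \<sigma> powr (- r) * mu powr (1 - r) * a powr (1 / (r + 1))"
    using a assms(1,4) by (simp add: powr_diff powr_minus field_simps)
  finally have "lam / (s * mu - lam) powr r =
      \<sigma> powr (- r) * mu powr (1 - r) * a powr (1 / (r + 1))" .
  moreover have "lam * waiting_time_moment r mu lam s =
      Gamma (r + 1) * erlang_C (lam / (s * mu)) s * (lam / (s * mu - lam) powr r)"
    unfolding waiting_time_moment_eq(2)[OF assms(3,1) s assms(2)] by simp
  ultimately show ?thesis by (simp add: q_hat_def a_def)
qed

theorem proposition3:
  fixes mu r :: real
  assumes "mu > 0" and "r > 1"
  shows "\<exists>\<epsilon> :: real \<Rightarrow> real \<Rightarrow> real. \<forall>\<sigma>>0.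
    (\<forall>lam>0.
       lam * waiting_time_moment r mu lam (lam / mu + \<sigma> * (lam / mu) powr (1 / (r + 1))) =
       q_hat r mu \<sigma> * (lam / mu) powr (1 / (r + 1)) +
       \<epsilon> lam \<sigma> * (lam / mu) powr ((3 - r) / (2 * (r + 1)))) \<and>
    (\<lambda>lam. \<epsilon> lam \<sigma>) \<in> O[at_top](\<lambda>_. 1)"
proof -
  define s where "s lam \<sigma> = lam / mu + \<sigma> * (lam / mu) powr (1 / (r + 1))" for lam \<sigma>
  define C where "C lam \<sigma> = erlang_C (lam / (s lam \<sigma> * mu)) (s lam \<sigma>)" for lam \<sigma>
  (* The exponent is forced by the required form of the error:
     1 / (r + 1) - (3 - r) / (2 * (r + 1)) = (r - 1) / (2 * (r + 1)). *)
  define \<epsilon> where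
    "\<epsilon> lam \<sigma> = q_hat r mu \<sigma> * (C lam \<sigma> - 1) * (lam / mu) powr ((r - 1) / (2 * (r + 1)))" for lam \<sigma>
  have expansion: "lam * waiting_time_moment r mu lam (s lam \<sigma>) =
       q_hat r mu \<sigma> * (lam / mu) powr (1 / (r + 1)) +
       \<epsilon> lam \<sigma> * (lam / mu) powr ((3 - r) / (2 * (r + 1)))"
    if "\<sigma> > 0" "lam > 0" for lam \<sigma>
  proof -
    have "(r - 1) / (2 * (r + 1)) + (3 - r) / (2 * (r + 1)) = 1 / (r + 1)"
      using assms by (simp add: divide_simps)
    hence "(lam / mu) powr ((r - 1) / (2 * (r + 1))) * (lam / mu) powr ((3 - r) / (2 * (r + 1)))
       = (lam / mu) powr (1 / (r + 1))"
      by (simp flip: powr_add)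
    hence "\<epsilon> lam \<sigma> * (lam / mu) powr ((3 - r) / (2 * (r + 1))) =
       q_hat r mu \<sigma> * (C lam \<sigma> - 1) * (lam / mu) powr (1 / (r + 1))"
      by (simp add: \<epsilon>_def mult.assoc)
    thus ?thesis
      using scaled_waiting_time_moment[of mu r lam \<sigma>] that assms
      by (simp add: s_def C_def algebra_simps)
  qed
  have bounded: "(\<lambda>lam. \<epsilon> lam \<sigma>) \<in> O[at_top](\<lambda>_. 1)" if \<sigma>: "\<sigma> > 0" for \<sigma>
  proof (rule bigoI)
    have q: "q_hat r mu \<sigma> \<ge> 0"
      using assms \<sigma> by (auto simp: q_hat_def intro!: mult_nonneg_nonneg Gamma_real_nonneg)
    have load: "filterlim (\<lambda>lam. lam / mu) at_top at_top"
      using assms by real_asymp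
    have "((\<lambda>a. a powr (1 / (r + 1) - 1 / 2)) \<longlongrightarrow> 0) at_top"
      using assms by (intro tendsto_neg_powr filterlim_ident) (simp add: field_simps)
    hence "\<forall>\<^sub>F a in at_top. a powr (1 / (r + 1) - 1 / 2) < 1 / (4 * \<sigma>)"
      using \<sigma> by (intro order_tendstoD(2)) auto
    hence "\<forall>\<^sub>F a in at_top. a \<ge> 1 \<and> a powr (1 / (r + 1) - 1 / 2) < 1 / (4 * \<sigma>)"
      using eventually_ge_at_top[of 1] by eventually_elim simp
    hence ev: "\<forall>\<^sub>F lam in at_top. lam / mu \<ge> 1 \<and>
        (lam / mu) powr (1 / (r + 1) - 1 / 2) < 1 / (4 * \<sigma>)"
      by (rule eventually_compose_filterlim[OF _ load])
    thus "\<forall>\<^sub>F lam in at_top.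
        norm (\<epsilon> lam \<sigma>) \<le> (q_hat r mu \<sigma> * \<sigma> * 4 * exp (1 / 2)) * norm (1 :: real)"
    proof eventually_elim
      case (elim lam)
      define a where "a = lam / mu"
      have a: "a \<ge> 1" using elim by (simp add: a_def)
      have lam: "lam > 0" using a assms by (auto simp: a_def intro: less_le_trans)
      have s: "s lam \<sigma> = a + \<sigma> * a powr (1 / (r + 1))" by (simp add: s_def a_def)
      have gt: "s lam \<sigma> > lam / mu" using lam assms \<sigma> by (simp add: s a_def)
      have "a powr (1 / (r + 1) - 1 / 2) < 1 / (4 * \<sigma>)"
        using elim unfolding a_def by blast
      hence "a powr (1 / (r + 1)) / sqrt a < 1 / (4 * \<sigma>)"
        unfolding powr_diff using a by (simp add: powr_half_sqrt)
      hence "4 * (\<sigma> * a powr (1 / (r + 1))) < sqrt a"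
        using a \<sigma> by (simp add: field_simps)
      hence "s lam \<sigma> - 1 \<le> a + sqrt a / 4" unfolding s by linarith
      hence J: "erlang_J a (s lam \<sigma> - 1) \<le> 4 * exp (1 / 2) / sqrt a"
        by (rule erlang_J_le_inverse_sqrt[OF a])
      have C: "C lam \<sigma> \<le> 1"
        unfolding C_def by (rule erlang_C_range(2)[OF lam assms(1) gt])
      have "1 - C lam \<sigma> \<le> \<sigma> * a powr (1 / (r + 1)) * erlang_J a (s lam \<sigma> - 1)"
        using one_minus_erlang_C_le[OF lam assms(1) gt] by (simp add: C_def s a_def)
      also have "\<dots> \<le> \<sigma> * a powr (1 / (r + 1)) * (4 * exp (1 / 2) / sqrt a)"
        using J \<sigma> by (intro mult_left_mono) auto
      finally have C': "1 - C lam \<sigma> \<le> \<sigma> * a powr (1 / (r + 1)) * (4 * exp (1 / 2) / sqrt a)" .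
      have "1 / (r + 1) + (r - 1) / (2 * (r + 1)) = 1 / 2"
        using assms by (simp add: divide_simps) (simp add: algebra_simps)
      hence scale: "a powr (1 / (r + 1)) * a powr ((r - 1) / (2 * (r + 1))) = sqrt a"
        using a unfolding powr_add[symmetric] by (simp only: powr_half_sqrt)
      have "norm (\<epsilon> lam \<sigma>) = q_hat r mu \<sigma> * (1 - C lam \<sigma>) * a powr ((r - 1) / (2 * (r + 1)))"
        using C q by (simp add: \<epsilon>_def a_def abs_mult)
      also have "\<dots> \<le> q_hat r mu \<sigma> * (\<sigma> * a powr (1 / (r + 1)) * (4 * exp (1 / 2) / sqrt a))
          * a powr ((r - 1) / (2 * (r + 1)))"
        using C' q by (intro mult_right_mono mult_left_mono) auto
      also have "\<dots> = q_hat r mu \<sigma> * \<sigma> * (4 * exp (1 / 2) / sqrt a) *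
          (a powr (1 / (r + 1)) * a powr ((r - 1) / (2 * (r + 1))))"
        by (simp only: mult_ac)
      also have "\<dots> = q_hat r mu \<sigma> * \<sigma> * 4 * exp (1 / 2)"
        unfolding scale using a by simp
      finally show ?case by simp
    qed
  qed
  show ?thesis
    using expansion bounded by (intro exI[of _ \<epsilon>]) (auto simp: s_def)
qed

end
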